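(* Let $p>2$ be a prime number and let $G\neq\{e\}$ be a finite $p$-group. Then there exists a normal subgroup $N$ of $G$ such that $\log_p|G:N|\leq b(G)$ and $cl(N)\leq b(G)+1$.
   Context: For $x\in G$, the breadth is $b(x):=\log_p|G:Z_G(x)|$, where $Z_G(x)$ is the centralizer of $x$ in $G$, and $b(G):=\max_{g\in G}b(g)$. $cl(N)$ denotes the nilpotency class of $N$. *)

theory Defs
  imports Complex_Main "HOL-Algebra.Algebra"
begin

definition centralizer_of :: "('a, 'b) monoid_scheme \<Rightarrow> 'a \<Rightarrow> 'a set" where
  "centralizer_of G x = {g \<in> carrier G. g \<otimes>\<^bsub>G\<^esub> x = x \<otimes>\<^bsub>G\<^esub> g}"

definition group_index :: "('a, 'b) monoid_scheme \<Rightarrow> 'a set \<Rightarrow> real" where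
  "group_index G H = real (card (carrier G)) / real (card H)"

definition breadth :: "('a, 'b) monoid_scheme \<Rightarrow> nat \<Rightarrow> 'a \<Rightarrow> real" where
  "breadth G p x = log (real p) (group_index G (centralizer_of G x))"

definition group_breadth :: "('a, 'b) monoid_scheme \<Rightarrow> nat \<Rightarrow> real" where
  "group_breadth G p = Max ((breadth G p) ` carrier G)"

definition commutator_subgroup :: "('a, 'b) monoid_scheme \<Rightarrow> 'a set \<Rightarrow> 'a set \<Rightarrow> 'a set" where
  "commutator_subgroup G A B = generate G
     {a \<otimes>\<^bsub>G\<^esub> b \<otimes>\<^bsub>G\<^esub> inv\<^bsub>G\<^esub> a \<otimes>\<^bsub>G\<^esub> inv\<^bsub>G\<^esub> b | a b. a \<in> A \<and> b \<in> B}"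

text \<open>Lower central series: lcs G 0 = G (= gamma_1), lcs G (i+1) = [lcs G i, G].\<close>
fun lower_central :: "('a, 'b) monoid_scheme \<Rightarrow> nat \<Rightarrow> 'a set" where
  "lower_central G 0 = carrier G"
| "lower_central G (Suc i) = commutator_subgroup G (lower_central G i) (carrier G)"

definition nil_class :: "('a, 'b) monoid_scheme \<Rightarrow> nat" where
  "nil_class G = (LEAST c. lower_central G c = {\<one>\<^bsub>G\<^esub>})"

end

theory Submission
  imports Defs
begin

text \<open>
  Let $c$ be the class of $G$, $b = b(G)$, and let $C_i$ be the centralizer of
  $\gamma_i/\gamma_{i+2}$ for $1 \le i < c$, a proper normal subgroup of index $p^{d_i}$. If
  $x \notin C_i$, then the chain $\gamma_j Z_G(x)$ drops strictly from $j = i$ to $j = i + 1$, so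
  $b(x)$ is at least the number of $i$ with $x \notin C_i$. Averaging over $x$ gives
  $\sum_i (1 - p^{-d_i}) \le b$. Intersecting the $C_i$ over a set $J$ without consecutive
  elements yields a normal subgroup $N$ of index at most $p^{\sum_J d_i}$ and of class at most
  $c - |J|$, since $[\gamma_i, N] \le \gamma_{i+2}$ for $i \in J$ saves one step each. As
  $p \ge 3$, the averaged inequality leaves room for a $J$ with $|J| \ge c - 1 - b$ and
  $\sum_J d_i \le b$: take the cheapest indices in the parity class that carries at least
  half of $\sum_i p^{-d_i}$.
\<close>

section \<open>Choosing a cheap sparse subset of indices\<close>

text \<open>Greedy choice: a cheapest element of the remainder is added until \<open>k\<close>
  elements are chosen.\<close>

lemma ex_smallest_subset:
  fixes d :: "'a \<Rightarrow> 'b::linorder"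
  assumes "finite P" "k \<le> card P"
  shows "\<exists>J\<subseteq>P. card J = k \<and> (\<forall>i\<in>J. \<forall>j\<in>P - J. d i \<le> d j)"
  using assms(2)
proof (induction k)
  case 0
  show ?case by (rule exI[of _ "{}"]) auto
next
  case (Suc k)
  then obtain J where J: "J \<subseteq> P" "card J = k" "\<forall>i\<in>J. \<forall>j\<in>P - J. d i \<le> d j" by auto
  have fin: "finite (P - J)" "finite J" using assms(1) J(1) finite_subset by auto
  have ne: "P - J \<noteq> {}"
    using Suc.prems J(1,2) fin(2) card_mono by fastforce
  obtain s where s: "s \<in> P - J" "\<forall>j\<in>P - J. d s \<le> d j"
    using fin(1) ne by (metis arg_min_if_finite(1) arg_min_least)
  show ?case
  proof (intro exI[of _ "insert s J"] conjI)
    show "insert s J \<subseteq> P" using s(1) J(1) by auto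
    show "card (insert s J) = Suc k" using s(1) J(2) fin(2) by simp
    show "\<forall>i\<in>insert s J. \<forall>j\<in>P - insert s J. d i \<le> d j" using s J(3) by auto
  qed
qed

text \<open>Rounding of a fractional selection: weights in [0,1] of total at least \<open>k\<close>
  cannot cost less than the \<open>k\<close> cheapest elements taken with weight 1.\<close>

lemma ex_subset_sum_le_weighted:
  fixes d :: "'a \<Rightarrow> nat" and w :: "'a \<Rightarrow> real"
  assumes "finite P" and w: "\<And>i. i \<in> P \<Longrightarrow> 0 \<le> w i" "\<And>i. i \<in> P \<Longrightarrow> w i \<le> 1"
    and k: "real k \<le> (\<Sum>i\<in>P. w i)"
  shows "\<exists>J\<subseteq>P. card J = k \<and> real (\<Sum>i\<in>J. d i) \<le> (\<Sum>i\<in>P. w i * real (d i))"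
proof (cases "k = 0")
  case True
  have "0 \<le> (\<Sum>i\<in>P. w i * real (d i))" using w by (intro sum_nonneg) simp
  then show ?thesis using True by (intro exI[of _ "{}"]) auto
next
  case False
  have "(\<Sum>i\<in>P. w i) \<le> real (card P)" using sum_mono[of P w "\<lambda>_. 1"] w by simp
  then have "k \<le> card P" using k by linarith
  then obtain J where J: "J \<subseteq> P" "card J = k" "\<forall>i\<in>J. \<forall>j\<in>P - J. d i \<le> d j"
    using ex_smallest_subset[OF assms(1), of k d] by blast
  have fJ: "finite J" "J \<noteq> {}" using J False assms(1) finite_subset by auto
  \<comment> \<open>The largest chosen cost separates \<open>J\<close> from its complement:
    \<open>d i - D\<close> is nonpositive on \<open>J\<close> and nonnegative on
    \<open>P - J\<close>. Hence lowering the coefficients on \<open>J\<close> from 1 to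
    \<open>w i\<close>, and then adding the terms of \<open>P - J\<close>, can only increase the
    sum.\<close>
  define D where "D = Max (d ` J)"
  have DJ: "d i \<le> D" if "i \<in> J" for i using that fJ D_def by simp
  have "D \<in> d ` J" using fJ D_def by simp
  then have DP: "D \<le> d j" if "j \<in> P - J" for j using that J(3) by auto
  have "(\<Sum>i\<in>J. real (d i) - D) \<le> (\<Sum>i\<in>J. w i * (real (d i) - D))"
  proof (rule sum_mono)
    fix i assume i: "i \<in> J"
    have "0 \<le> (1 - w i) * (real D - real (d i))" using w(2)[of i] DJ[OF i] i J(1) by auto
    then show "real (d i) - D \<le> w i * (real (d i) - D)" by (simp add: algebra_simps)
  qed
  also have "\<dots> \<le> (\<Sum>i\<in>P. w i * (real (d i) - D))"
    using w(1) DP J(1) assms(1) by (intro sum_mono2) auto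
  also have "\<dots> = (\<Sum>i\<in>P. w i * real (d i)) - D * (\<Sum>i\<in>P. w i)"
    by (simp add: algebra_simps sum_subtractf sum_distrib_left)
  \<comment> \<open>As \<open>card J = k\<close>, the same \<open>D * real k\<close> is subtracted
    on the left of the chain, so it cancels.\<close>
  also have "\<dots> \<le> (\<Sum>i\<in>P. w i * real (d i)) - D * real k"
    using k by (simp add: mult_left_mono)
  finally show ?thesis using J by (intro exI[of _ J]) (simp add: sum_subtractf algebra_simps)
qed

text \<open>The weights are twice \<open>r i = 1 / p ^ d i\<close>, restricted to one parity class.
  Their total is at least \<open>m - b\<close>, and their cost is at most \<open>2/3 * m\<close>
  because \<open>r i * d i \<le> 1/3\<close>; the hypothesis together with
  \<open>r i \<le> 1/3\<close> bounds \<open>2/3 * m\<close> by \<open>b\<close>.\<close>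

lemma ex_sparse_cheap_subset:
  fixes d :: "nat \<Rightarrow> nat"
  assumes p: "(3::nat) \<le> p" and d: "\<And>i. i < m \<Longrightarrow> 1 \<le> d i"
    and b: "(\<Sum>i<m. 1 - 1 / real p ^ d i) \<le> real b"
  shows "\<exists>J\<subseteq>{..<m}. (\<forall>i\<in>J. Suc i \<notin> J) \<and> m \<le> card J + b \<and> (\<Sum>i\<in>J. d i) \<le> b"
proof -
  define r where "r i = 1 / real p ^ d i" for i
  \<comment> \<open>This is where \<open>p \<ge> 3\<close> enters: it gives
    \<open>3 * d i \<le> 3 ^ d i \<le> p ^ d i\<close>. At \<open>j = 0\<close> the truncated
    exponent is 0, which is harmless.\<close>
  have three: "real j \<le> 3 ^ (j - 1)" for j :: nat
  proof (induction j)
    case (Suc j)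
    then show ?case by (cases j) auto
  qed simp
  have r0: "0 \<le> r i" for i by (simp add: r_def)
  have rd: "r i * real (d i) \<le> 1 / 3" if "i < m" for i
  proof -
    have "3 * real (d i) \<le> 3 * 3 ^ (d i - 1)" using three[of "d i"] by simp
    also have "\<dots> = 3 ^ d i" using d[OF that] by (simp flip: power_Suc)
    also have "\<dots> \<le> real p ^ d i" using p by (intro power_mono) auto
    finally show ?thesis using p by (simp add: r_def field_simps)
  qed
  have r3: "r i \<le> 1 / 3" if "i < m" for i
    using rd[OF that] mult_left_mono[of 1 "real (d i)" "r i"] d[OF that] r0[of i] by simp
  have b': "real m - real b \<le> (\<Sum>i<m. r i)" using b by (simp add: sum_subtractf r_def)
  have "(\<Sum>i<m. r i) \<le> m / 3" using sum_mono[of "{..<m}" r "\<lambda>_. 1/3"] r3 by simp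
  then have b23: "2 / 3 * real m \<le> real b" using b' by simp
  \<comment> \<open>Truncated subtraction: for \<open>b \<ge> m\<close> this is 0 and the empty set
    is chosen.\<close>
  define k where "k = m - b"
  have k: "real k \<le> (\<Sum>i<m. r i)"
    using b' sum_nonneg[of "{..<m}" r] r0 by (auto simp: k_def of_nat_diff_if)
  have split: "(\<Sum>i<m. r i) = (\<Sum>i | i < m \<and> even i. r i) + (\<Sum>i | i < m \<and> odd i. r i)"
    by (subst sum.union_disjoint[symmetric]) (auto intro!: sum.cong)
  \<comment> \<open>A parity class contains no two consecutive indices, and the heavier of the two
    carries at least half of the sum.\<close>
  obtain P where P: "P \<subseteq> {..<m}" "\<forall>i\<in>P. Suc i \<notin> P" "real k \<le> 2 * (\<Sum>i\<in>P. r i)"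
  proof (cases "(\<Sum>i | i < m \<and> even i. r i) \<le> (\<Sum>i | i < m \<and> odd i. r i)")
    case True
    show ?thesis using that[of "{i. i < m \<and> odd i}"] True k split by auto
  next
    case False
    show ?thesis using that[of "{i. i < m \<and> even i}"] False k split by auto
  qed
  \<comment> \<open>The weights \<open>2 * r i\<close> have total at least \<open>k\<close> on \<open>P\<close>, and \<open>r i \<le> 1 / 3\<close> keeps them below 1.\<close>
  have "\<exists>J\<subseteq>P. card J = k \<and> real (\<Sum>i\<in>J. d i) \<le> (\<Sum>i\<in>P. 2 * r i * real (d i))"
  proof (rule ex_subset_sum_le_weighted)
    show "finite P" using P(1) finite_subset by blast
    show "2 * r i \<le> 1" if "i \<in> P" for i using r3[of i] that P(1) by auto
  qed (use P(3) r0 in \<open>auto simp: sum_distrib_left\<close>)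
  then obtain J where J: "J \<subseteq> P" "card J = k"
    "real (\<Sum>i\<in>J. d i) \<le> (\<Sum>i\<in>P. 2 * r i * real (d i))" by blast
  have "(\<Sum>i\<in>P. 2 * r i * real (d i)) \<le> (\<Sum>i\<in>P. 2 / 3)"
    using rd P(1) by (intro sum_mono) fastforce
  also have "\<dots> \<le> 2 / 3 * real m"
    using card_mono[OF _ P(1)] by simp
  finally have "real (\<Sum>i\<in>J. d i) \<le> real b" using J(3) b23 by linarith
  then have "(\<Sum>i\<in>J. d i) \<le> b" by linarith
  then show ?thesis using J P k_def by (intro exI[of _ J]) auto
qed

section \<open>Commutators and relative centralizers\<close>

text \<open>For normal \<open>K\<close>, this is the preimage in \<open>G\<close> of the centralizer
  of the image of \<open>A\<close> in \<open>G/K\<close>. Phrasing it by commutators avoids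
  computing in factor groups.\<close>

definition relative_centralizer :: "('a, 'b) monoid_scheme \<Rightarrow> 'a set \<Rightarrow> 'a set \<Rightarrow> 'a set" where
  "relative_centralizer G A K =
     {x \<in> carrier G. \<forall>a\<in>A. a \<otimes>\<^bsub>G\<^esub> x \<otimes>\<^bsub>G\<^esub> inv\<^bsub>G\<^esub> a \<otimes>\<^bsub>G\<^esub> inv\<^bsub>G\<^esub> x \<in> K}"

context group
begin

lemma mult_inv_cancel_left:
  assumes "x \<in> carrier G" "y \<in> carrier G"
  shows "x \<otimes> (inv x \<otimes> y) = y" "inv x \<otimes> (x \<otimes> y) = y"
  using assms by (simp_all flip: m_assoc)

text \<open>These bring group words to a right-associated reduced form, so that identities of the
  free group are settled by simplification.\<close>

lemmas word_simps = m_assoc inv_mult_group mult_inv_cancel_left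

text \<open>The two commutators are inverse to each other.\<close>

lemma normal_inv_commutator_mem_iff:
  assumes "K \<lhd> G" "a \<in> carrier G" "x \<in> carrier G"
  shows "a \<otimes> x \<otimes> inv a \<otimes> inv x \<in> K \<longleftrightarrow> x \<otimes> a \<otimes> inv x \<otimes> inv a \<in> K"
proof -
  have *: "inv (u \<otimes> v \<otimes> inv u \<otimes> inv v) = v \<otimes> u \<otimes> inv v \<otimes> inv u"
    if "u \<in> carrier G" "v \<in> carrier G" for u v
    using that by (simp add: word_simps)
  then show ?thesis
    using assms normal_imp_subgroup subgroup.m_inv_closed by metis
qed

lemma relative_centralizer_subset: "relative_centralizer G A K \<subseteq> carrier G"
  by (auto simp: relative_centralizer_def)

text \<open>Writing [a,x] for the commutator, closure follows from the identities [a,x^-1] = x^-1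
  [a,x]^-1 x and [a,xy] = [a,x] (x [a,y] x^-1). For normality, conjugating x by t is traded for
  conjugating a by t^-1, which stays in \<open>A\<close>.\<close>

lemma relative_centralizer_normal:
  assumes A: "A \<lhd> G" and K: "K \<lhd> G"
  shows "relative_centralizer G A K \<lhd> G"
proof -
  interpret A: normal A G by fact
  interpret K: normal K G by fact
  show ?thesis
  proof (rule normal_invI)
    show "subgroup (relative_centralizer G A K) G"
    proof (rule subgroupI)
      show "relative_centralizer G A K \<noteq> {}"
        by (auto simp: relative_centralizer_def intro!: exI[of _ \<one>])
    next
      fix x assume x: "x \<in> relative_centralizer G A K"
      have "a \<otimes> inv x \<otimes> inv a \<otimes> inv (inv x) = inv x \<otimes> inv (a \<otimes> x \<otimes> inv a \<otimes> inv x) \<otimes> x"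
        if "a \<in> A" for a
        using that x by (simp add: word_simps relative_centralizer_def)
      moreover have "inv x \<otimes> inv (a \<otimes> x \<otimes> inv a \<otimes> inv x) \<otimes> x \<in> K" if "a \<in> A" for a
        using that x by (intro K.inv_op_closed1) (auto simp: relative_centralizer_def)
      ultimately show "inv x \<in> relative_centralizer G A K"
        using x by (simp add: relative_centralizer_def)
    next
      fix x y assume xy: "x \<in> relative_centralizer G A K" "y \<in> relative_centralizer G A K"
      have "a \<otimes> (x \<otimes> y) \<otimes> inv a \<otimes> inv (x \<otimes> y)
          = (a \<otimes> x \<otimes> inv a \<otimes> inv x) \<otimes> (x \<otimes> (a \<otimes> y \<otimes> inv a \<otimes> inv y) \<otimes> inv x)"
        if "a \<in> A" for a
        using that xy by (simp add: word_simps relative_centralizer_def)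
      moreover have "(a \<otimes> x \<otimes> inv a \<otimes> inv x) \<otimes> (x \<otimes> (a \<otimes> y \<otimes> inv a \<otimes> inv y) \<otimes> inv x) \<in> K"
        if "a \<in> A" for a
        using that xy
        by (intro K.m_closed[OF _ K.inv_op_closed2]) (simp_all add: relative_centralizer_def)
      ultimately show "x \<otimes> y \<in> relative_centralizer G A K"
        using xy by (simp add: relative_centralizer_def)
    qed (auto simp: relative_centralizer_def)
  next
    fix t x assume t: "t \<in> carrier G" and x: "x \<in> relative_centralizer G A K"
    have "a \<otimes> (t \<otimes> x \<otimes> inv t) \<otimes> inv a \<otimes> inv (t \<otimes> x \<otimes> inv t)
        = t \<otimes> ((inv t \<otimes> a \<otimes> t) \<otimes> x \<otimes> inv (inv t \<otimes> a \<otimes> t) \<otimes> inv x) \<otimes> inv t"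
      if "a \<in> A" for a
      using that x t by (simp add: word_simps relative_centralizer_def)
    moreover have "t \<otimes> ((inv t \<otimes> a \<otimes> t) \<otimes> x \<otimes> inv (inv t \<otimes> a \<otimes> t) \<otimes> inv x) \<otimes> inv t \<in> K"
      if "a \<in> A" for a
      using that x t A.inv_op_closed1[OF t that]
      by (intro K.inv_op_closed2) (auto simp: relative_centralizer_def)
    ultimately show "t \<otimes> x \<otimes> inv t \<in> relative_centralizer G A K"
      using x t by (simp add: relative_centralizer_def)
  qed
qed

lemma commutator_subgroup_normal:
  assumes A: "A \<lhd> G" and B: "B \<lhd> G"
  shows "commutator_subgroup G A B \<lhd> G"
  unfolding commutator_subgroup_def
proof (rule normal_generateI)
  interpret A: normal A G by fact
  interpret B: normal B G by fact
  show "{a \<otimes> b \<otimes> inv a \<otimes> inv b |a b. a \<in> A \<and> b \<in> B} \<subseteq> carrier G" by auto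
  fix h g assume "h \<in> {a \<otimes> b \<otimes> inv a \<otimes> inv b |a b. a \<in> A \<and> b \<in> B}" and g: "g \<in> carrier G"
  then obtain a b where ab: "a \<in> A" "b \<in> B" "h = a \<otimes> b \<otimes> inv a \<otimes> inv b" by auto
  have "g \<otimes> h \<otimes> inv g = (g \<otimes> a \<otimes> inv g) \<otimes> (g \<otimes> b \<otimes> inv g)
      \<otimes> inv (g \<otimes> a \<otimes> inv g) \<otimes> inv (g \<otimes> b \<otimes> inv g)"
    using ab g by (simp add: word_simps)
  then show "g \<otimes> h \<otimes> inv g \<in> {a \<otimes> b \<otimes> inv a \<otimes> inv b |a b. a \<in> A \<and> b \<in> B}"
    using A.inv_op_closed2[OF g ab(1)] B.inv_op_closed2[OF g ab(2)] by blast
qed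

lemma commutator_subgroup_subsetI:
  assumes "subgroup K G" "\<And>a b. a \<in> A \<Longrightarrow> b \<in> B \<Longrightarrow> a \<otimes> b \<otimes> inv a \<otimes> inv b \<in> K"
  shows "commutator_subgroup G A B \<subseteq> K"
  unfolding commutator_subgroup_def using assms by (intro generate_subgroup_incl) auto

lemma commutator_mem_commutator_subgroup:
  "a \<in> A \<Longrightarrow> b \<in> B \<Longrightarrow> a \<otimes> b \<otimes> inv a \<otimes> inv b \<in> commutator_subgroup G A B"
  unfolding commutator_subgroup_def by (blast intro: generate.incl)

lemma normal_commutator_mem:
  assumes "K \<lhd> G" "a \<in> K" "x \<in> carrier G"
  shows "a \<otimes> x \<otimes> inv a \<otimes> inv x \<in> K"
proof -
  interpret K: normal K G by fact
  have "a \<otimes> (x \<otimes> inv a \<otimes> inv x) \<in> K"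
    using assms by (intro K.m_closed K.inv_op_closed2) auto
  then show ?thesis using assms by (simp add: m_assoc)
qed

lemma lower_central_normal: "lower_central G i \<lhd> G"
  by (induction i) (auto intro: commutator_subgroup_normal normal_self)

lemmas lower_central_subgroup = lower_central_normal[THEN normal_imp_subgroup]

lemma lower_central_Suc_subset: "lower_central G (Suc i) \<subseteq> lower_central G i"
  unfolding lower_central.simps
  by (intro commutator_subgroup_subsetI lower_central_subgroup normal_commutator_mem lower_central_normal)

lemma centralizer_of_subgroup:
  assumes "x \<in> carrier G"
  shows "subgroup (centralizer_of G x) G"
proof (rule subgroupI)
  fix g assume g: "g \<in> centralizer_of G x"
  then have gc: "g \<in> carrier G" and "inv g \<otimes> (g \<otimes> x) \<otimes> inv g = inv g \<otimes> (x \<otimes> g) \<otimes> inv g"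
    by (simp_all add: centralizer_of_def)
  then have "x \<otimes> inv g = inv g \<otimes> x" using assms by (simp add: word_simps)
  then show "inv g \<in> centralizer_of G x" using gc by (simp add: centralizer_of_def)
next
  fix g h assume gh: "g \<in> centralizer_of G x" "h \<in> centralizer_of G x"
  then have c: "g \<in> carrier G" "h \<in> carrier G" "g \<otimes> x = x \<otimes> g" "h \<otimes> x = x \<otimes> h"
    by (simp_all add: centralizer_of_def)
  have "(g \<otimes> h) \<otimes> x = x \<otimes> (g \<otimes> h)" using c assms by (metis m_assoc)
  then show "g \<otimes> h \<in> centralizer_of G x" using c by (simp add: centralizer_of_def)
qed (use assms in \<open>auto simp: centralizer_of_def intro: exI[of _ \<one>]\<close>)

section \<open>Indices of intersections of subgroups\<close>

text \<open>The fibres \<open>F g\<close> of the multiplication map from \<open>A \<times> B\<close>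
  to \<open>G\<close> have at most \<open>card (A \<inter> B)\<close> elements: once (a,b) is fixed
  in a fibre, (u,v) is determined by a^-1 u = b v^-1, an element of both subgroups.\<close>

lemma card_mult_card_le_card_Int:
  assumes A: "subgroup A G" and B: "subgroup B G" and fin: "finite (carrier G)"
  shows "card A * card B \<le> card (carrier G) * card (A \<inter> B)"
proof -
  interpret A: subgroup A G by fact
  interpret B: subgroup B G by fact
  define F where "F g = {(a, b). a \<in> A \<and> b \<in> B \<and> a \<otimes> b = g}" for g
  have finAB: "finite A" "finite B" using fin A.subset B.subset finite_subset by auto
  have finF: "finite (F g)" for g
    using finAB by (intro finite_subset[OF _ finite_cartesian_product[of A B]]) (auto simp: F_def)
  have le: "card (F g) \<le> card (A \<inter> B)" for g
  proof (cases "F g = {}")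
    case False
    then obtain a b where ab: "a \<in> A" "b \<in> B" "a \<otimes> b = g" by (auto simp: F_def)
    show ?thesis
    proof (rule card_inj_on_le[of "\<lambda>(u, v). inv a \<otimes> u"])
      show "inj_on (\<lambda>(u, v). inv a \<otimes> u) (F g)"
        using ab by (auto simp: inj_on_def F_def)
          (metis A.mem_carrier B.mem_carrier l_cancel)
      have "inv a \<otimes> u \<in> A \<inter> B" if "u \<in> A" "v \<in> B" "u \<otimes> v = g" for u v
      proof -
        have "inv a \<otimes> (u \<otimes> v) \<otimes> inv v = inv a \<otimes> (a \<otimes> b) \<otimes> inv v" using that ab by simp
        moreover have "inv a \<otimes> (u \<otimes> v) \<otimes> inv v = inv a \<otimes> u" "inv a \<otimes> (a \<otimes> b) \<otimes> inv v = b \<otimes> inv v"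
          using that(1,2) ab(1,2) by (simp_all add: word_simps)
        ultimately have "inv a \<otimes> u = b \<otimes> inv v" by simp
        then show ?thesis using that ab by (metis A.m_closed A.m_inv_closed B.m_closed B.m_inv_closed IntI)
      qed
      then show "(\<lambda>(u, v). inv a \<otimes> u) ` F g \<subseteq> A \<inter> B" by (auto simp: F_def)
    qed (use finAB in auto)
  qed simp
  have "A \<times> B = (\<Union>g\<in>carrier G. F g)" by (auto simp: F_def)
  then have "card A * card B = card (\<Union>g\<in>carrier G. F g)" by (simp flip: card_cartesian_product)
  also have "\<dots> \<le> (\<Sum>g\<in>carrier G. card (F g))" by (rule card_UN_le[OF fin])
  also have "\<dots> \<le> card (carrier G) * card (A \<inter> B)"
    using sum_mono[of "carrier G" "\<lambda>g. card (F g)" "\<lambda>_. card (A \<inter> B)"] le by simp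
  finally show ?thesis .
qed

text \<open>The factor \<open>carrier G\<close> makes the empty family yield the whole
  group.\<close>

lemma normal_INT:
  assumes "finite J" "\<And>i. i \<in> J \<Longrightarrow> S i \<lhd> G"
  shows "carrier G \<inter> (\<Inter>i\<in>J. S i) \<lhd> G"
  using assms
proof (induction J)
  case empty
  show ?case using normal_self by simp
next
  case (insert i J)
  then have "S i \<inter> (carrier G \<inter> (\<Inter>i\<in>J. S i)) \<lhd> G"
    using normal_subgroup_intersect[of "S i"] by simp
  moreover have "S i \<inter> (carrier G \<inter> (\<Inter>i\<in>J. S i)) = carrier G \<inter> (\<Inter>i\<in>insert i J. S i)" by auto
  ultimately show ?case by simp
qed

text \<open>The index of an intersection is at most the product of the indices, written without
  division.\<close>

lemma card_carrier_le_card_INT: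
  assumes fin: "finite (carrier G)" and "finite J"
    and "\<And>i. i \<in> J \<Longrightarrow> S i \<lhd> G"
    and "\<And>i. i \<in> J \<Longrightarrow> card (carrier G) = q ^ d i * card (S i)"
  shows "card (carrier G) \<le> q ^ (\<Sum>i\<in>J. d i) * card (carrier G \<inter> (\<Inter>i\<in>J. S i))"
  using assms(2-)
proof (induction J)
  case empty
  show ?case by simp
next
  case (insert i J)
  let ?N = "carrier G \<inter> (\<Inter>i\<in>J. S i)"
  have "?N \<lhd> G" using insert.prems insert.hyps by (intro normal_INT) auto
  then have le: "card (S i) * card ?N \<le> card (carrier G) * card (S i \<inter> ?N)"
    using insert.prems by (intro card_mult_card_le_card_Int fin normal_imp_subgroup) auto
  \<comment> \<open>The bounds for \<open>S i\<close> and for \<open>?N\<close> are multiplied; one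
    factor \<open>card (carrier G)\<close> is cancelled at the end.\<close>
  have "card (carrier G) * card (carrier G)
      \<le> (q ^ d i * card (S i)) * (q ^ (\<Sum>i\<in>J. d i) * card ?N)"
    using insert.prems insert.IH by (metis insert_iff mult_le_mono2)
  also have "\<dots> = q ^ (\<Sum>i\<in>insert i J. d i) * (card (S i) * card ?N)"
    using insert.hyps by (simp add: power_add)
  also have "\<dots> \<le> q ^ (\<Sum>i\<in>insert i J. d i) * (card (carrier G) * card (S i \<inter> ?N))"
    using le by (rule mult_left_mono) simp
  also have "S i \<inter> ?N = carrier G \<inter> (\<Inter>i\<in>insert i J. S i)" by auto
  finally show ?case using fin one_closed by (auto simp: card_gt_0_iff mult.left_commute)
qed

section \<open>Nilpotency class of a subgroup that centralizes double steps\<close>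

text \<open>Steps in \<open>J\<close> jump from \<open>i\<close> to \<open>i + 2\<close>, so the indices in \<open>Suc ` J\<close> are not counted. The lower
  central series is indexed from 0, so \<open>lower_central G i\<close> is $\gamma_{i+1}$.\<close>

lemma lower_central_subgroup_skip:
  assumes N: "subgroup N G"
    and J: "\<And>i. i \<in> J \<Longrightarrow> Suc i \<notin> J"
    and NJ: "\<And>i. i \<in> J \<Longrightarrow> N \<subseteq> relative_centralizer G (lower_central G i) (lower_central G (i + 2))"
  shows "lower_central (G\<lparr>carrier := N\<rparr>) (card ({..<i} - Suc ` J)) \<subseteq> lower_central G i"
proof -
  let ?N = "G\<lparr>carrier := N\<rparr>"
  interpret N: group ?N using N by (rule subgroup_imp_group)
  have inN: "lower_central ?N j \<subseteq> N" for j
    using N.lower_central_subgroup[of j] subgroup.subset by force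
  have step: "lower_central ?N (Suc j) \<subseteq> K"
    if K: "subgroup K G"
      and c: "\<And>a b. a \<in> lower_central ?N j \<Longrightarrow> b \<in> N \<Longrightarrow> a \<otimes> b \<otimes> inv a \<otimes> inv b \<in> K" for j K
  proof -
    \<comment> \<open>\<open>K\<close> may reach outside \<open>N\<close>; the intersection is a
      subgroup of \<open>?N\<close>, so it can bound a subgroup generated there.\<close>
    have "subgroup (K \<inter> N) ?N"
      using K N by (intro subgroup_incl subgroups_Inter_pair) auto
    moreover have "a \<otimes> b \<otimes> inv\<^bsub>?N\<^esub> a \<otimes> inv\<^bsub>?N\<^esub> b \<in> K \<inter> N"
      if "a \<in> lower_central ?N j" "b \<in> N" for a b
      using that c[OF that] inN[of j] N
      by (auto simp: subset_iff subgroup.m_inv_closed subgroup.m_closed)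
    ultimately show ?thesis
      using N.commutator_subgroup_subsetI[of "K \<inter> N" "lower_central ?N j" N] by auto
  qed
  show ?thesis
  proof (induction i rule: less_induct)
    case (less i)
    show ?case
    proof (cases i)
      case 0
      then show ?thesis using subgroup.subset[OF N] by simp
    next
      case (Suc s)
      show ?thesis
      proof (cases "s \<in> Suc ` J")
        case False
        then have "card ({..<i} - Suc ` J) = Suc (card ({..<s} - Suc ` J))"
          by (simp add: Suc lessThan_Suc insert_Diff_if)
        moreover have "lower_central ?N (Suc (card ({..<s} - Suc ` J))) \<subseteq> lower_central G (Suc s)"
          using less[of s] Suc subgroup.subset[OF N]
          by (intro step lower_central_subgroup)
            (auto intro!: commutator_mem_commutator_subgroup)
        ultimately show ?thesis using Suc by simp
      next
        case True
        then obtain t where t: "t \<in> J" "s = Suc t" by auto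
        \<comment> \<open>Here \<open>i = t + 2\<close>. By sparsity \<open>t\<close> is counted,
          while \<open>t + 1\<close> is not, so a single step in \<open>N\<close> covers two steps
          of the series of \<open>G\<close>.\<close>
        have "t \<notin> Suc ` J" using t J by auto
        then have "card ({..<i} - Suc ` J) = Suc (card ({..<t} - Suc ` J))"
          using t by (simp add: Suc lessThan_Suc insert_Diff_if)
        moreover have "lower_central ?N (Suc (card ({..<t} - Suc ` J))) \<subseteq> lower_central G (t + 2)"
          using less[of t] Suc t NJ[OF t(1)]
          by (intro step lower_central_subgroup) (auto simp: relative_centralizer_def subset_iff)
        ultimately show ?thesis using Suc t by simp
      qed
    qed
  qed
qed

lemma nil_class_subgroup_le:
  assumes N: "subgroup N G" and c: "lower_central G c = {\<one>}"
    and J: "J \<subseteq> {..<c - 1}" "\<And>i. i \<in> J \<Longrightarrow> Suc i \<notin> J"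
    and NJ: "\<And>i. i \<in> J \<Longrightarrow> N \<subseteq> relative_centralizer G (lower_central G i) (lower_central G (i + 2))"
  shows "nil_class (G\<lparr>carrier := N\<rparr>) \<le> c - card J"
proof -
  interpret N: group "G\<lparr>carrier := N\<rparr>" using N by (rule subgroup_imp_group)
  have "Suc ` J \<subseteq> {..<c}" using J(1) by auto
  then have "card ({..<c} - Suc ` J) = c - card J"
    using card_Diff_subset[of "Suc ` J" "{..<c}"] finite_subset[of "Suc ` J" "{..<c}"]
    by (simp add: card_image)
  then have "lower_central (G\<lparr>carrier := N\<rparr>) (c - card J) \<subseteq> {\<one>}"
    using lower_central_subgroup_skip[OF N J(2) NJ, where i = c] c by simp
  then have "lower_central (G\<lparr>carrier := N\<rparr>) (c - card J) = {\<one>}"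
    using subgroup.one_closed[OF N.lower_central_subgroup[of "c - card J"]] by auto
  then show ?thesis unfolding nil_class_def by (intro Least_le) simp
qed

end

section \<open>Finite p-groups\<close>

text \<open>The moved points of an invariant set split into orbits, each of size a power of
  \<open>p\<close> greater than 1.\<close>

lemma (in group_action) prime_dvd_card_non_fixed:
  assumes p: "Factorial_Ring.prime (p::nat)" and n: "order G = p ^ n"
    and F: "F \<subseteq> E" "finite F" "\<And>g x. g \<in> carrier G \<Longrightarrow> x \<in> F \<Longrightarrow> \<phi> g x \<in> F"
  shows "p dvd card {x \<in> F. \<exists>g\<in>carrier G. \<phi> g x \<noteq> x}"
proof -
  let ?U = "{x \<in> F. \<exists>g\<in>carrier G. \<phi> g x \<noteq> x}"
  \<comment> \<open>A fixed point is alone in its orbit, so the orbit of a moved point contains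
    none.\<close>
  have sub: "orbit G \<phi> x \<subseteq> ?U" if x: "x \<in> ?U" for x
  proof
    fix y assume y: "y \<in> orbit G \<phi> x"
    then have yF: "y \<in> F" using F(3) x unfolding orbit_def by blast
    have "x \<in> orbit G \<phi> y" using orbit_sym[of x y] x yF F(1) y by blast
    have "\<exists>g\<in>carrier G. \<phi> g y \<noteq> y"
    proof (rule ccontr)
      assume "\<not> ?thesis"
      then have fixed: "\<phi> g y = y" if "g \<in> carrier G" for g using that by auto
      obtain g where "g \<in> carrier G" "x = \<phi> g y"
        using \<open>x \<in> orbit G \<phi> y\<close> unfolding orbit_def by blast
      then have "x = y" using fixed by simp
      then show False using x fixed by blast
    qed
    then show "y \<in> ?U" using yF by simp
  qed
  have "?U = \<Union> (orbit G \<phi> ` ?U)"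
  proof
    show "?U \<subseteq> \<Union> (orbit G \<phi> ` ?U)" using orbit_refl F(1) by blast
    show "\<Union> (orbit G \<phi> ` ?U) \<subseteq> ?U" using sub by blast
  qed
  moreover have "p dvd card (\<Union> (orbit G \<phi> ` ?U))"
  proof (rule dvd_partition)
    show "finite (\<Union> (orbit G \<phi> ` ?U))"
    proof (rule finite_subset[OF _ F(2)])
      show "\<Union> (orbit G \<phi> ` ?U) \<subseteq> F" using sub by blast
    qed
    show "\<forall>c\<in>orbit G \<phi> ` ?U. p dvd card c"
    proof
      fix c assume "c \<in> orbit G \<phi> ` ?U"
      then obtain x where x: "x \<in> ?U" and c: "c = orbit G \<phi> x" by auto
      have xE: "x \<in> E" using x F(1) by auto
      have fin: "finite c" using sub[OF x] F(2) c finite_subset[of c F] by blast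
      obtain g where g: "g \<in> carrier G" "\<phi> g x \<noteq> x" using x by auto
      have "{x, \<phi> g x} \<subseteq> c" using g orbit_refl[OF xE] unfolding c orbit_def by blast
      then have "2 \<le> card c" using card_mono[OF fin, of "{x, \<phi> g x}"] g(2) by simp
      have "card c dvd p ^ n"
        using orbit_stabilizer_theorem[OF xE] n c by (metis dvd_triv_left)
      then obtain j where "card c = p ^ j" using divides_primepow_nat[OF p] by blast
      with \<open>2 \<le> card c\<close> show "p dvd card c" by (cases j) auto
    qed
    show "\<forall>c1\<in>orbit G \<phi> ` ?U. \<forall>c2\<in>orbit G \<phi> ` ?U. c1 \<noteq> c2 \<longrightarrow> c1 \<inter> c2 = {}"
    proof (intro ballI impI)
      fix c1 c2 assume c: "c1 \<in> orbit G \<phi> ` ?U" "c2 \<in> orbit G \<phi> ` ?U" "c1 \<noteq> c2"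
      have "orbit G \<phi> ` ?U \<subseteq> orbits G E \<phi>" using F(1) unfolding orbits_def by blast
      then show "c1 \<inter> c2 = {}" using disjoint_union[of c1 c2] c by (meson subsetD)
    qed
  qed
  ultimately show ?thesis by simp
qed

locale finite_p_group = group G for G :: "('a, 'b) monoid_scheme" (structure) +
  fixes p :: nat
  assumes prime_p: "Factorial_Ring.prime p" and finite_carrier: "finite (carrier G)"
    and card_carrier: "\<exists>n. card (carrier G) = p ^ n"
begin

lemma p_gt_1: "1 < p"
  using prime_p by (rule prime_gt_1_nat)

lemma card_subgroup:
  assumes "subgroup H G"
  obtains j where "card H = p ^ j"
proof -
  obtain n where "card (carrier G) = p ^ n" using card_carrier by blast
  then have "card H dvd p ^ n" using lagrange[OF assms] unfolding order_def by (metis dvd_triv_right)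
  then show ?thesis using that divides_primepow_nat[OF prime_p] by blast
qed

lemma card_carrier_eq_index:
  assumes "subgroup H G"
  obtains d where "card (carrier G) = p ^ d * card H"
proof -
  obtain n where n: "card (carrier G) = p ^ n" using card_carrier by blast
  obtain j where j: "card H = p ^ j" using assms by (rule card_subgroup)
  have "card H \<le> card (carrier G)"
    using finite_carrier subgroup.subset[OF assms] by (rule card_mono)
  then have "j \<le> n" using n j p_gt_1 by simp
  then show ?thesis using that[of "n - j"] n j by (simp flip: power_add)
qed

lemma p_mult_card_le:
  assumes "subgroup H G" "subgroup K G" "H \<subset> K"
  shows "p * card H \<le> card K"
proof -
  obtain i where i: "card H = p ^ i" using assms(1) by (rule card_subgroup)
  obtain j where j: "card K = p ^ j" using assms(2) by (rule card_subgroup)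
  have "finite K" using finite_carrier subgroup.subset[OF assms(2)] finite_subset by blast
  then have "card H < card K" using assms(3) by (rule psubset_card_mono)
  then have "Suc i \<le> j" using i j p_gt_1 by simp
  then have "p ^ Suc i \<le> p ^ j" using p_gt_1 by (intro power_increasing) auto
  then show ?thesis using i j by simp
qed

lemma group_index_eq_power:
  assumes "card (carrier G) = p ^ d * card H" "subgroup H G"
  shows "group_index G H = real p ^ d"
proof -
  have "card H \<noteq> 0"
    using finite_subset[OF subgroup.subset[OF assms(2)] finite_carrier]
      subgroup.one_closed[OF assms(2)] by auto
  then show ?thesis unfolding group_index_def using assms(1) by simp
qed

section \<open>Central elements modulo a normal subgroup, and nilpotency\<close>

lemma r_coset_conjugate:
  assumes K: "K \<lhd> G" and gh: "g \<in> carrier G" "h \<in> carrier G"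
  shows "g <# (K #> h) #> inv g = K #> (g \<otimes> h \<otimes> inv g)"
proof -
  interpret K: normal K G by fact
  have "g <# (K #> h) = (g <# K) #> h" using coset_assoc gh K.subset by metis
  also have "\<dots> = (K #> g) #> h" using K.coset_eq gh(1) by simp
  also have "\<dots> = K #> (g \<otimes> h)" using gh K.subset by (intro coset_mult_assoc)
  finally have "g <# (K #> h) = K #> (g \<otimes> h)" .
  then show ?thesis using gh K.subset by (simp add: coset_mult_assoc)
qed

text \<open>The nontrivial normal subgroup \<open>H/K\<close> of the p-group \<open>G/K\<close>
  meets its centre nontrivially. The group acts by conjugation on the cosets of \<open>K\<close> in
  \<open>H\<close>; the number of fixed cosets is divisible by \<open>p\<close>, and
  \<open>K\<close> itself is one of them.\<close>

lemma ex_central_mod: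
  assumes H: "H \<lhd> G" and K: "K \<lhd> G" and KH: "K \<subset> H"
  shows "\<exists>h\<in>H - K. \<forall>g\<in>carrier G. g \<otimes> h \<otimes> inv g \<otimes> inv h \<in> K"
proof -
  interpret H: normal H G by fact
  interpret K: normal K G by fact
  \<comment> \<open>The action is taken on all subsets of the group; the cosets form the invariant
    part \<open>F\<close>, and \<open>U\<close> collects those that are moved.\<close>
  define E where "E = {S. S \<subseteq> carrier G}"
  define \<phi> where "\<phi> = (\<lambda>g. \<lambda>S\<in>E. g <# S #> inv g)"
  interpret act: group_action G E \<phi>
    unfolding \<phi>_def E_def by (rule action_by_conjugation_on_power_set)
  define F where "F = (\<lambda>h. K #> h) ` H"
  define U where "U = {x \<in> F. \<exists>g\<in>carrier G. \<phi> g x \<noteq> x}"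
  have Hsub: "H \<subseteq> carrier G" by (rule H.subset)
  have finH: "finite H" using finite_carrier Hsub finite_subset by blast
  then have finF: "finite F" by (simp add: F_def)
  have FE: "F \<subseteq> E" using Hsub r_coset_subset_G[OF K.subset] unfolding F_def E_def by blast
  have \<phi>_coset: "\<phi> g (K #> h) = K #> (g \<otimes> h \<otimes> inv g)" if "g \<in> carrier G" "h \<in> H" for g h
  proof -
    have "K #> h \<in> E" using FE that(2) by (auto simp: F_def)
    then show ?thesis using that Hsub r_coset_conjugate[OF K, of g h] by (simp add: \<phi>_def subset_iff)
  qed
  obtain n where n: "order G = p ^ n" using card_carrier by (auto simp: order_def)
  have dvdU: "p dvd card U"
    unfolding U_def
  proof (rule act.prime_dvd_card_non_fixed[OF prime_p n FE finF])
    fix g x assume g: "g \<in> carrier G" and "x \<in> F"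
    then obtain h where h: "h \<in> H" "x = K #> h" by (auto simp: F_def)
    have "K #> (g \<otimes> h \<otimes> inv g) \<in> F" using H.inv_op_closed2[OF g h(1)] by (simp add: F_def)
    then show "\<phi> g x \<in> F" using \<phi>_coset[OF g h(1)] h(2) by simp
  qed
  \<comment> \<open>The number of cosets is the index of \<open>K\<close> in \<open>H\<close>, a
    power of \<open>p\<close> that exceeds 1 as \<open>K\<close> is proper.\<close>
  have "p dvd card F"
  proof -
    interpret GH: group "G\<lparr>carrier := H\<rparr>" by (rule subgroup_imp_group[OF H.subgroup_axioms])
    have "subgroup K (G\<lparr>carrier := H\<rparr>)"
      using KH by (intro subgroup_incl K.subgroup_axioms H.subgroup_axioms) auto
    then have "card (rcosets\<^bsub>G\<lparr>carrier := H\<rparr>\<^esub> K) * card K = card H"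
      using GH.lagrange[of K] by (simp add: order_def)
    moreover have "rcosets\<^bsub>G\<lparr>carrier := H\<rparr>\<^esub> K = F"
      by (auto simp: RCOSETS_def F_def)
    ultimately have FK: "card F * card K = card H" by simp
    obtain j where "card H = p ^ j" using H.subgroup_axioms by (rule card_subgroup)
    then have "card F dvd p ^ j" using FK by (metis dvd_triv_left)
    then obtain i where i: "card F = p ^ i" using divides_primepow_nat[OF prime_p] by blast
    have "card K < card H" using finH KH by (rule psubset_card_mono)
    then show ?thesis using FK i by (cases i) auto
  qed
  moreover have UF: "U \<subseteq> F" by (auto simp: U_def)
  then have "card F = card U + card (F - U)"
    using card_Un_disjoint[of U "F - U"] finF finite_subset[OF UF] by (simp add: Un_absorb1)
  ultimately have dvd: "p dvd card (F - U)" using dvdU by (simp add: dvd_add_right_iff)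
  have "\<phi> g (K #> \<one>) = K #> \<one>" if "g \<in> carrier G" for g
    using \<phi>_coset[OF that H.one_closed] that by simp
  then have "K #> \<one> \<in> F - U"
    using H.one_closed unfolding F_def U_def by blast
  then have "0 < card (F - U)" using finF card_gt_0_iff by blast
  then have "2 \<le> card (F - U)" using dvd_imp_le[OF dvd] p_gt_1 by linarith
  then have "\<not> F - U \<subseteq> {K #> \<one>}" using card_mono[of "{K #> \<one>}" "F - U"] by fastforce
  then obtain y where y: "y \<in> F - U" "y \<noteq> K #> \<one>" by blast
  then obtain h where h: "h \<in> H" "y = K #> h" by (auto simp: F_def)
  have hc: "h \<in> carrier G" using h Hsub by auto
  have "h \<notin> K"
    using y(2) h(2) hc coset_join2[OF hc K.subgroup_axioms] coset_mult_one[OF K.subset] by auto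
  moreover have "g \<otimes> h \<otimes> inv g \<otimes> inv h \<in> K" if g: "g \<in> carrier G" for g
  proof -
    have "\<phi> g y = y" using y(1) g by (simp add: U_def)
    then have "K #> (g \<otimes> h \<otimes> inv g) = K #> h" using h(2) \<phi>_coset[OF g h(1)] by simp
    then have "g \<otimes> h \<otimes> inv g \<in> K #> h"
      using rcos_self[OF _ K.subgroup_axioms, of "g \<otimes> h \<otimes> inv g"] g hc by simp
    then show ?thesis using K.rcos_module_imp[OF group_axioms hc, of "g \<otimes> h \<otimes> inv g"] by simp
  qed
  ultimately show ?thesis using h(1) by blast
qed

text \<open>Let \<open>K\<close> be maximal among the normal subgroups of \<open>G\<close> properly
  inside \<open>H\<close>. The part of \<open>H\<close> that is central modulo \<open>K\<close> is
  normal and strictly larger than \<open>K\<close>, so it is all of \<open>H\<close>, and the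
  commutators fall into \<open>K\<close>.\<close>

lemma commutator_subgroup_psubset:
  assumes H: "H \<lhd> G" and H1: "H \<noteq> {\<one>}"
  shows "commutator_subgroup G H (carrier G) \<subset> H"
proof -
  interpret H: normal H G by fact
  define \<K> where "\<K> = {K. K \<lhd> G \<and> K \<subset> H}"
  have "\<K> \<subseteq> Pow (carrier G)" using H.subset by (auto simp: \<K>_def)
  then have fin: "finite \<K>" by (rule finite_subset) (simp add: finite_carrier)
  have "{\<one>} \<subset> H" using H.one_closed H1 by blast
  then have "{\<one>} \<in> \<K>" using one_is_normal by (simp add: \<K>_def)
  then obtain K where "K \<in> \<K>" and max: "\<forall>M\<in>\<K>. K \<subseteq> M \<longrightarrow> K = M"
    using finite_has_maximal[OF fin] by blast
  then have KN: "K \<lhd> G" and KH: "K \<subset> H" by (simp_all add: \<K>_def)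
  let ?M = "H \<inter> relative_centralizer G (carrier G) K"
  have M: "?M \<lhd> G" using H KN normal_self by (intro normal_subgroup_intersect relative_centralizer_normal)
  have "K \<subseteq> ?M"
  proof
    fix x assume x: "x \<in> K"
    then have "x \<in> H" using KH by blast
    then have "x \<in> carrier G" using H.subset by blast
    have "a \<otimes> x \<otimes> inv a \<otimes> inv x \<in> K" if "a \<in> carrier G" for a
      using normal_inv_commutator_mem_iff[OF KN that \<open>x \<in> carrier G\<close>]
        normal_commutator_mem[OF KN x that] by blast
    then show "x \<in> ?M"
      using \<open>x \<in> H\<close> \<open>x \<in> carrier G\<close> by (simp add: relative_centralizer_def)
  qed
  moreover obtain h where "h \<in> H - K" "\<forall>g\<in>carrier G. g \<otimes> h \<otimes> inv g \<otimes> inv h \<in> K"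
    using ex_central_mod[OF H KN KH] by blast
  then have "h \<in> ?M - K" using H.subset unfolding relative_centralizer_def by blast
  ultimately have "?M \<notin> \<K>" using max by blast
  then have HM: "?M = H" using M by (simp add: \<K>_def psubset_eq)
  have "commutator_subgroup G H (carrier G) \<subseteq> K"
  proof (rule commutator_subgroup_subsetI[OF normal_imp_subgroup[OF KN]])
    fix a b assume ab: "a \<in> H" "b \<in> carrier G"
    then have "a \<in> relative_centralizer G (carrier G) K" using HM by blast
    then have a: "a \<in> carrier G" "b \<otimes> a \<otimes> inv b \<otimes> inv a \<in> K"
      using ab(2) by (simp_all add: relative_centralizer_def)
    then show "a \<otimes> b \<otimes> inv a \<otimes> inv b \<in> K"
      using normal_inv_commutator_mem_iff[OF KN a(1) ab(2)] by blast
  qed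
  then show ?thesis using KH by blast
qed

lemma lower_central_Suc_psubset:
  "lower_central G i \<noteq> {\<one>} \<Longrightarrow> lower_central G (Suc i) \<subset> lower_central G i"
  using commutator_subgroup_psubset[OF lower_central_normal] by simp

text \<open>The \<open>LEAST\<close> in \<open>nil_class\<close> is meaningful only if the series
  reaches the trivial group; otherwise every step would lose an element, which finiteness
  forbids.\<close>

lemma lower_central_nil_class: "lower_central G (nil_class G) = {\<one>}"
proof -
  have "\<exists>c. lower_central G c = {\<one>}"
  proof (rule ccontr)
    assume ne: "\<not> ?thesis"
    have "card (lower_central G i) + i \<le> card (carrier G)" for i
    proof (induction i)
      case (Suc i)
      have "finite (lower_central G i)"
        by (rule finite_subset[OF subgroup.subset[OF lower_central_subgroup] finite_carrier])
      then have "card (lower_central G (Suc i)) < card (lower_central G i)"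
        using lower_central_Suc_psubset[of i] ne by (intro psubset_card_mono) auto
      then show ?case using Suc by simp
    qed simp
    from this[of "Suc (card (carrier G))"] show False by simp
  qed
  then show ?thesis unfolding nil_class_def by (rule LeastI_ex)
qed

lemma lower_central_ne_one:
  "i < nil_class G \<Longrightarrow> lower_central G i \<noteq> {\<one>}"
  unfolding nil_class_def by (rule not_less_Least)

section \<open>Breadth\<close>

text \<open>With indices starting at 0, this is the subgroup C_(i+1) of the overview.\<close>

abbreviation two_step_centralizer :: "nat \<Rightarrow> 'a set" where
  "two_step_centralizer i \<equiv> relative_centralizer G (lower_central G i) (lower_central G (i + 2))"

lemma two_step_centralizer_normal: "two_step_centralizer i \<lhd> G"
  by (intro relative_centralizer_normal lower_central_normal)

text \<open>Equality would make the lower central series stationary at \<open>Suc i\<close>, before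
  it is trivial.\<close>

lemma two_step_centralizer_ne_carrier:
  assumes "Suc i < nil_class G"
  shows "two_step_centralizer i \<noteq> carrier G"
proof
  assume eq: "two_step_centralizer i = carrier G"
  have "lower_central G (Suc i) \<subseteq> lower_central G (Suc (Suc i))"
    unfolding lower_central.simps(2)[of G i]
  proof (rule commutator_subgroup_subsetI[OF lower_central_subgroup])
    fix a b assume "a \<in> lower_central G i" "b \<in> carrier G"
    then show "a \<otimes> b \<otimes> inv a \<otimes> inv b \<in> lower_central G (Suc (Suc i))"
      using eq by (auto simp: relative_centralizer_def set_eq_iff)
  qed
  then show False using lower_central_Suc_psubset lower_central_ne_one assms by blast
qed

text \<open>If g = hz with z centralizing x, then [g,x] = [h,x], which lies one term deeper because
  h does. Contrapositively, an \<open>x\<close> outside forces a strict drop in the chain of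
  products with its centralizer.\<close>

lemma two_step_centralizer_memI:
  assumes x: "x \<in> carrier G"
    and sub: "lower_central G i \<subseteq> lower_central G (Suc i) <#> centralizer_of G x"
  shows "x \<in> two_step_centralizer i"
proof -
  have "g \<otimes> x \<otimes> inv g \<otimes> inv x \<in> lower_central G (i + 2)" if g: "g \<in> lower_central G i" for g
  proof -
    obtain h z where hz: "h \<in> lower_central G (Suc i)" "z \<in> centralizer_of G x" "g = h \<otimes> z"
      using sub g by (auto simp: set_mult_def)
    have c: "h \<in> carrier G" "z \<in> carrier G" "z \<otimes> x = x \<otimes> z"
      using hz(2) subgroup.mem_carrier[OF lower_central_subgroup hz(1)]
      by (simp_all add: centralizer_of_def)
    have "g \<otimes> x \<otimes> inv g \<otimes> inv x = h \<otimes> (z \<otimes> x \<otimes> inv z) \<otimes> inv h \<otimes> inv x"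
      using hz(3) c(1,2) x by (simp add: word_simps)
    also have "z \<otimes> x \<otimes> inv z = x" using c x by (simp add: m_assoc)
    also have "h \<otimes> x \<otimes> inv h \<otimes> inv x \<in> commutator_subgroup G (lower_central G (Suc i)) (carrier G)"
      using hz(1) x by (rule commutator_mem_commutator_subgroup)
    finally show ?thesis by simp
  qed
  then show ?thesis using x by (simp add: relative_centralizer_def)
qed

text \<open>Along the descending chain of subgroups \<open>?T i\<close>, all containing the
  centralizer, each index with \<open>x\<close> outside costs a factor of at least
  \<open>p\<close>.\<close>

lemma power_card_le_index_centralizer:
  assumes x: "x \<in> carrier G"
  shows "p ^ card {i. i < m \<and> x \<notin> two_step_centralizer i} * card (centralizer_of G x)
      \<le> card (carrier G)"
proof -
  let ?Z = "centralizer_of G x"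
  let ?T = "\<lambda>i. lower_central G i <#> ?Z"
  have Z: "subgroup ?Z G" using x by (rule centralizer_of_subgroup)
  have grp: "second_isomorphism_grp (lower_central G i) G ?Z" for i
    using lower_central_normal Z by (simp add: second_isomorphism_grp_def second_isomorphism_grp_axioms_def)
  have T: "subgroup (?T i) G" for i
    using second_isomorphism_grp.normal_set_mult_subgroup[OF grp] .
  have finT: "finite (?T i)" for i
    by (rule finite_subset[OF subgroup.subset[OF T] finite_carrier])
  have "p ^ card {i. i < m \<and> x \<notin> two_step_centralizer i} * card (?T m) \<le> card (carrier G)"
  proof (induction m)
    case 0
    then show ?case using card_mono[OF finite_carrier subgroup.subset[OF T[of 0]]] by simp
  next
    case (Suc m)
    have sub: "?T (Suc m) \<subseteq> ?T m"
      using lower_central_Suc_subset by (intro mono_set_mult) auto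
    show ?case
    proof (cases "x \<in> two_step_centralizer m")
      case True
      then have "{i. i < Suc m \<and> x \<notin> two_step_centralizer i}
          = {i. i < m \<and> x \<notin> two_step_centralizer i}"
        using less_Suc_eq by auto
      moreover have "card (?T (Suc m)) \<le> card (?T m)" using finT sub by (rule card_mono)
      ultimately show ?thesis using Suc by (simp del: lower_central.simps) (meson le_trans mult_le_mono2)
    next
      case False
      then have "{i. i < Suc m \<and> x \<notin> two_step_centralizer i}
          = insert m {i. i < m \<and> x \<notin> two_step_centralizer i}"
        using less_Suc_eq by auto
      \<comment> \<open>Since \<open>lower_central G m\<close> lies in \<open>?T m\<close>, equality
        would put \<open>x\<close> into the two-step centralizer.\<close>
      moreover have "?T (Suc m) \<noteq> ?T m"
        using False two_step_centralizer_memI[OF x, of m]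
          second_isomorphism_grp.H_contained_in_set_mult[OF grp, of m] by auto
      then have "p * card (?T (Suc m)) \<le> card (?T m)"
        using sub by (intro p_mult_card_le T) auto
      then have "p ^ card {i. i < m \<and> x \<notin> two_step_centralizer i} * (p * card (?T (Suc m)))
          \<le> card (carrier G)"
        using Suc by (meson le_trans mult_le_mono2)
      ultimately show ?thesis by (simp add: mult.assoc mult.left_commute del: lower_central.simps)
    qed
  qed
  moreover have "card ?Z \<le> card (?T m)"
    using finT second_isomorphism_grp.S_contained_in_set_mult[OF grp] by (rule card_mono)
  ultimately show ?thesis by (meson le_trans mult_le_mono2)
qed

lemma breadth_eq_of_nat:
  assumes "x \<in> carrier G"
  obtains d where "breadth G p x = real d" "card (carrier G) = p ^ d * card (centralizer_of G x)"
proof -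
  have Z: "subgroup (centralizer_of G x) G" using assms by (rule centralizer_of_subgroup)
  then obtain d where d: "card (carrier G) = p ^ d * card (centralizer_of G x)"
    by (rule card_carrier_eq_index)
  have "breadth G p x = real d"
    unfolding breadth_def group_index_eq_power[OF d Z] using p_gt_1 by (simp add: log_nat_power)
  then show ?thesis using that d by blast
qed

lemma card_le_breadth:
  assumes "x \<in> carrier G"
  shows "real (card {i. i < m \<and> x \<notin> two_step_centralizer i}) \<le> breadth G p x"
proof -
  obtain d where d: "breadth G p x = real d" "card (carrier G) = p ^ d * card (centralizer_of G x)"
    using assms by (rule breadth_eq_of_nat)
  have "card (carrier G) \<noteq> 0" using finite_carrier one_closed by auto
  then have "p ^ card {i. i < m \<and> x \<notin> two_step_centralizer i} \<le> p ^ d"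
    using power_card_le_index_centralizer[OF assms, of m] d(2) by simp
  then show ?thesis using d(1) p_gt_1 by simp
qed

lemma breadth_le_group_breadth: "x \<in> carrier G \<Longrightarrow> breadth G p x \<le> group_breadth G p"
  unfolding group_breadth_def using finite_carrier by (intro Max_ge) auto

lemma group_breadth_eq_of_nat:
  obtains b where "group_breadth G p = real b"
proof -
  have "group_breadth G p \<in> breadth G p ` carrier G"
    unfolding group_breadth_def using finite_carrier one_closed by (intro Max_in) auto
  then obtain x where "x \<in> carrier G" "group_breadth G p = breadth G p x" by blast
  then show ?thesis using that breadth_eq_of_nat by metis
qed

section \<open>Averaging over the elements of the group\<close>

text \<open>Double counting of the pairs (i,x) with \<open>x\<close> outside the i-th two-step
  centralizer: each \<open>x\<close> occurs in at most \<open>breadth G p x\<close> of them.\<close>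

lemma sum_density_le_group_breadth:
  "(\<Sum>i<m. 1 - real (card (two_step_centralizer i)) / real (card (carrier G))) \<le> group_breadth G p"
proof -
  let ?C = two_step_centralizer
  have pos: "0 < card (carrier G)" using finite_carrier one_closed card_gt_0_iff by blast
  have "(\<Sum>i<m. real (card (carrier G)) - real (card (?C i)))
      = (\<Sum>i<m. \<Sum>x\<in>carrier G. of_bool (x \<notin> ?C i))"
  proof (rule sum.cong)
    fix i
    have "finite (?C i)" using relative_centralizer_subset finite_carrier by (rule finite_subset)
    then have "card (carrier G - ?C i) = card (carrier G) - card (?C i)"
      using relative_centralizer_subset by (intro card_Diff_subset)
    moreover have "card (?C i) \<le> card (carrier G)"
      using finite_carrier relative_centralizer_subset by (rule card_mono)
    moreover have "(\<Sum>x\<in>carrier G. of_bool (x \<notin> ?C i)) = real (card (carrier G - ?C i))"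
      using finite_carrier by (simp add: sum.If_cases of_bool_def Diff_eq Compl_eq)
    ultimately show "real (card (carrier G)) - real (card (?C i)) = (\<Sum>x\<in>carrier G. of_bool (x \<notin> ?C i))"
      by simp
  qed simp
  also have "\<dots> = (\<Sum>x\<in>carrier G. \<Sum>i<m. of_bool (x \<notin> ?C i))" by (rule sum.swap)
  also have "\<dots> \<le> (\<Sum>x\<in>carrier G. group_breadth G p)"
  proof (rule sum_mono)
    fix x assume x: "x \<in> carrier G"
    have "(\<Sum>i<m. of_bool (x \<notin> ?C i)) = real (card {i. i < m \<and> x \<notin> ?C i})"
      by (simp add: sum.If_cases of_bool_def Collect_conj_eq lessThan_def)
    then show "(\<Sum>i<m. of_bool (x \<notin> ?C i)) \<le> group_breadth G p"
      using card_le_breadth[OF x, of m] breadth_le_group_breadth[OF x] by simp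
  qed
  finally have le: "(\<Sum>i<m. real (card (carrier G)) - real (card (?C i)))
      \<le> group_breadth G p * real (card (carrier G))" by (simp add: mult.commute)
  have "(\<Sum>i<m. 1 - real (card (?C i)) / real (card (carrier G)))
      = (\<Sum>i<m. real (card (carrier G)) - real (card (?C i))) / real (card (carrier G))"
    unfolding sum_divide_distrib using pos by (intro sum.cong) (auto simp: diff_divide_distrib)
  then show ?thesis using le pos by (simp add: divide_le_eq)
qed

end

section \<open>Construction of the normal subgroup from the selected indices\<close>

theorem theorem2:
  fixes G (structure) and p :: nat
  assumes "Factorial_Ring.prime p" and "p > 2"
    and "group G" and "finite (carrier G)" and "\<exists>n. card (carrier G) = p ^ n"
    and "carrier G \<noteq> {\<one>\<^bsub>G\<^esub>}"
  shows "\<exists>N. N \<lhd> G \<and> log (real p) (group_index G N) \<le> group_breadth G p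
             \<and> real (nil_class (G\<lparr>carrier := N\<rparr>)) \<le> group_breadth G p + 1"
proof -
  interpret finite_p_group G p
    using assms by (simp add: finite_p_group_def finite_p_group_axioms_def)
  let ?C = two_step_centralizer
  obtain b where b: "group_breadth G p = real b" by (rule group_breadth_eq_of_nat)
  define m where "m = nil_class G - 1"
  \<comment> \<open>As the series starts with \<open>carrier G\<close>, nontriviality makes the
    class positive, so the subtraction in \<open>m\<close> is exact.\<close>
  have cG: "nil_class G = Suc m"
    using lower_central_nil_class assms(6) by (cases "nil_class G") (auto simp: m_def)
  have "\<forall>i. \<exists>d. card (carrier G) = p ^ d * card (?C i)"
    using card_carrier_eq_index[OF normal_imp_subgroup[OF two_step_centralizer_normal]] by metis
  then obtain d where d: "\<And>i. card (carrier G) = p ^ d i * card (?C i)" by metis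
  have pos: "card (carrier G) \<noteq> 0" using finite_carrier one_closed by auto
  have "\<exists>J\<subseteq>{..<m}. (\<forall>i\<in>J. Suc i \<notin> J) \<and> m \<le> card J + b \<and> (\<Sum>i\<in>J. d i) \<le> b"
  proof (rule ex_sparse_cheap_subset)
    show "3 \<le> p" using assms(2) by simp
    show "1 \<le> d i" if "i < m" for i
    proof (rule ccontr)
      assume "\<not> 1 \<le> d i"
      then have "card (?C i) = card (carrier G)"
        using d[of i] by (metis less_one linorder_not_le mult_1 power_0)
      then have "?C i = carrier G"
        using card_subset_eq[OF finite_carrier relative_centralizer_subset] by simp
      then show False using two_step_centralizer_ne_carrier that cG by simp
    qed
    have "1 / real p ^ d i = real (card (?C i)) / real (card (carrier G))" for i
      using pos d[of i] by (auto simp: field_simps)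
    then show "(\<Sum>i<m. 1 - 1 / real p ^ d i) \<le> real b"
      using sum_density_le_group_breadth[of m] b by simp
  qed
  then obtain J where J: "J \<subseteq> {..<m}" "\<And>i. i \<in> J \<Longrightarrow> Suc i \<notin> J" "m \<le> card J + b" "(\<Sum>i\<in>J. d i) \<le> b"
    by blast
  have finJ: "finite J" using J(1) finite_subset by blast
  define N where "N = carrier G \<inter> (\<Inter>i\<in>J. ?C i)"
  have N: "N \<lhd> G" unfolding N_def using finJ two_step_centralizer_normal by (rule normal_INT)
  have "card (carrier G) \<le> p ^ (\<Sum>i\<in>J. d i) * card N"
    unfolding N_def using finite_carrier finJ two_step_centralizer_normal d
    by (rule card_carrier_le_card_INT)
  moreover obtain e where e: "card (carrier G) = p ^ e * card N"
    using card_carrier_eq_index[OF normal_imp_subgroup[OF N]] .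
  \<comment> \<open>The factor \<open>card N\<close> cancels, being nonzero because
    \<open>card (carrier G)\<close> is.\<close>
  ultimately have "p ^ e \<le> p ^ (\<Sum>i\<in>J. d i)" using pos by simp
  then have "e \<le> b" using p_gt_1 J(4) by simp
  moreover have "log (real p) (group_index G N) = real e"
    unfolding group_index_eq_power[OF e normal_imp_subgroup[OF N]]
    using p_gt_1 by (simp add: log_nat_power)
  \<comment> \<open>With class \<open>m + 1\<close> and \<open>m \<le> card J + b\<close>, the saved
    steps leave at most \<open>b + 1\<close>.\<close>
  moreover have "nil_class (G\<lparr>carrier := N\<rparr>) \<le> nil_class G - card J"
    using J(1,2) cG
    by (intro nil_class_subgroup_le normal_imp_subgroup[OF N] lower_central_nil_class)
      (auto simp: N_def)
  then have "nil_class (G\<lparr>carrier := N\<rparr>) \<le> b + 1" using J(3) cG by linarith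
  ultimately show ?thesis using N b by (intro exI[of _ N]) simp
qed

end
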